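(* Let $A=(A(i,j))_{i,j\in\{1,\dots,N\}}$ be a square matrix with entries in $\{0,1\}$ such that no row of $A$ is identically zero and no column of $A$ is identically zero. Let $(X_A,\sigma_A)$ be the associated one-sided Markov subshift, $(\overline X_A,\overline\sigma_A)$ the associated two-sided Markov subshift, and let $(\widetilde X_A,\widetilde\sigma_A)$ be the reversible extension of $(X_A,\sigma_A)$. Then $$(\widetilde X_A,\widetilde\sigma_A)\cong(\overline X_A,\overline\sigma_A),$$ i.e. the two systems are topologically conjugate.
   Context: $\mathbb{N}=\{0,1,2,\dots\}$. $X_A=\{(x_k)_{k\in\mathbb{N}}\in\{1,\dots,N\}^{\mathbb{N}}:A(x_k,x_{k+1})=1,\ k\in\mathbb{N}\}$ with the topology inherited from the product space $\{1,\dots,N\}^{\mathbb{N}}$, and $(\sigma_Ax)_k=x_{k+1}$, $k\in\mathbb{N}$. $\overline X_A=\{(x_k)_{k\in\mathbb{Z}}\in\{1,\dots,N\}^{\mathbb{Z}}:A(x_k,x_{k+1})=1,\ k\in\mathbb{Z}\}$ with the topology inherited from the product, and $(\overline\sigma_Ax)_k=x_{k+1}$, $k\in\mathbb{Z}$. Reversible extension of $(X,\alpha)$, where $X$ is compact Hausdorff and $\alpha:\Delta_1\to X$ is continuous on the clopen set $\Delta_1\subset X$ with open image $\Delta_{-1}$ (here $X=\Delta_1=X_A$, $\alpha=\sigma_A$): let $\Delta_n$ be the domain of $\alpha^n$, $\Delta_0=X$, and adjoin to $X$ an isolated point, denoted $0$. $\widetilde X=\bigcup_{M\ge0}X_M\cup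 X_\infty\subset\prod_{n=0}^\infty(X\cup\{0\})$ with the induced product topology, where $X_M=\{(x_0,\dots,x_M,0,0,\dots):x_n\in\Delta_n,\ x_M\notin\Delta_{-1},\ \alpha(x_n)=x_{n-1}\text{ for }1\le n\le M\}$ and $X_\infty=\{(x_0,x_1,\dots):x_n\in\Delta_n,\ \alpha(x_n)=x_{n-1}\text{ for }n\ge1\}$; and $\widetilde\alpha(x_0,x_1,\dots)=(\alpha(x_0),x_0,x_1,\dots)$ for $(x_0,x_1,\dots)\in\widetilde X$ with $x_0\in\Delta_1$. The reversible extension is $(\widetilde X,\widetilde\alpha)$. *)

theory Defs
  imports "HOL-Analysis.Analysis"
begin

section \<open>Partial dynamical systems and conjugacy\<close>

text \<open>A triple \<open>(X, D, f)\<close> stands for the space \<open>X\<close> together with the partial map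
  \<open>f : D \<rightarrow> X\<close>. The values of the (total) HOL function \<open>f\<close> outside \<open>D\<close> carry no meaning.\<close>

type_synonym 'a pds = "'a topology \<times> 'a set \<times> ('a \<Rightarrow> 'a)"

definition topologically_conjugate :: "'a pds \<Rightarrow> 'b pds \<Rightarrow> bool" where
  "topologically_conjugate S T =
     (case S of (X, D, f) \<Rightarrow> case T of (Y, E, g) \<Rightarrow>
        \<exists>h. homeomorphic_map X Y h \<and> h ` D = E \<and> (\<forall>x\<in>D. h (f x) = g (h x)))"


section \<open>Markov subshifts\<close>

text \<open>Only the entries \<open>A i j\<close> with \<open>i, j \<in> {1..N}\<close> are matrix entries.\<close>

definition one_sided_space :: "nat \<Rightarrow> (nat \<Rightarrow> nat \<Rightarrow> nat) \<Rightarrow> (nat \<Rightarrow> nat) topology" where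
  "one_sided_space N A =
     subtopology (product_topology (\<lambda>k. discrete_topology {1..N}) UNIV)
       {x. (\<forall>k. x k \<in> {1..N}) \<and> (\<forall>k. A (x k) (x (k + 1)) = 1)}"

definition two_sided_space :: "nat \<Rightarrow> (nat \<Rightarrow> nat \<Rightarrow> nat) \<Rightarrow> (int \<Rightarrow> nat) topology" where
  "two_sided_space N A =
     subtopology (product_topology (\<lambda>k. discrete_topology {1..N}) UNIV)
       {x. (\<forall>k. x k \<in> {1..N}) \<and> (\<forall>k. A (x k) (x (k + 1)) = 1)}"

definition one_sided_subshift :: "nat \<Rightarrow> (nat \<Rightarrow> nat \<Rightarrow> nat) \<Rightarrow> (nat \<Rightarrow> nat) pds" where
  "one_sided_subshift N A =
     (one_sided_space N A, topspace (one_sided_space N A), \<lambda>x k. x (k + 1))"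

definition two_sided_subshift :: "nat \<Rightarrow> (nat \<Rightarrow> nat \<Rightarrow> nat) \<Rightarrow> (int \<Rightarrow> nat) pds" where
  "two_sided_subshift N A =
     (two_sided_space N A, topspace (two_sided_space N A), \<lambda>x k. x (k + 1))"


section \<open>The reversible extension\<close>

text \<open>The adjoined isolated point \<open>0\<close> is \<open>None\<close>; a point \<open>x\<close> of \<open>X\<close> becomes \<open>Some x\<close>.\<close>

definition adjoin_isolated :: "'a topology \<Rightarrow> 'a option topology" where
  "adjoin_isolated X = topology (\<lambda>U. openin X {x. Some x \<in> U})"

lemma openin_adjoin_isolated:
  "openin (adjoin_isolated X) U \<longleftrightarrow> openin X {x. Some x \<in> U}"
proof -
  have "istopology (\<lambda>U. openin X {x. Some x \<in> U})"
    unfolding istopology_def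
  proof (intro conjI allI impI)
    fix S T assume "openin X {x. Some x \<in> S}" "openin X {x. Some x \<in> T}"
    then have "openin X ({x. Some x \<in> S} \<inter> {x. Some x \<in> T})" by (rule openin_Int)
    then show "openin X {x. Some x \<in> S \<inter> T}" by (simp add: Collect_conj_eq)
  next
    fix \<K> assume "\<forall>K\<in>\<K>. openin X {x. Some x \<in> K}"
    then have "openin X (\<Union>K\<in>\<K>. {x. Some x \<in> K})" by blast
    moreover have "(\<Union>K\<in>\<K>. {x. Some x \<in> K}) = {x. Some x \<in> \<Union>\<K>}" by auto
    ultimately show "openin X {x. Some x \<in> \<Union>\<K>}" by simp
  qed
  then show ?thesis
    unfolding adjoin_isolated_def by (simp only: topology_inverse')
qed

lemma topspace_adjoin_isolated:
  "topspace (adjoin_isolated X) = insert None (Some ` topspace X)"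
proof
  have *: "openin X {x. Some x \<in> topspace (adjoin_isolated X)}"
    unfolding openin_adjoin_isolated[symmetric] by (rule openin_topspace)
  show "topspace (adjoin_isolated X) \<subseteq> insert None (Some ` topspace X)"
  proof
    fix z assume z: "z \<in> topspace (adjoin_isolated X)"
    show "z \<in> insert None (Some ` topspace X)"
    proof (cases z)
      case (Some x)
      then have "x \<in> {x. Some x \<in> topspace (adjoin_isolated X)}" using z by simp
      then show ?thesis using openin_subset[OF *] Some by blast
    qed simp
  qed
  have "{x. Some x \<in> insert None (Some ` topspace X)} = topspace X" by auto
  then have "openin (adjoin_isolated X) (insert None (Some ` topspace X))"
    by (simp only: openin_adjoin_isolated openin_topspace)
  then show "insert None (Some ` topspace X) \<subseteq> topspace (adjoin_isolated X)"
    by (rule openin_subset)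
qed

text \<open>The domain of the \<open>n\<close>-th iterate of the partial map \<open>f : D \<rightarrow> X\<close>.\<close>

fun iterate_domain :: "'a pds \<Rightarrow> nat \<Rightarrow> 'a set" where
  "iterate_domain (X, D, f) 0 = topspace X"
| "iterate_domain (X, D, f) (Suc n) = {x \<in> D. f x \<in> iterate_domain (X, D, f) n}"

text \<open>In the following two definitions \<open>y\<close> lists the coordinates lying in \<open>X\<close>.\<close>

definition finite_part :: "'a pds \<Rightarrow> nat \<Rightarrow> (nat \<Rightarrow> 'a option) set" where
  "finite_part S M =
     (case S of (X, D, f) \<Rightarrow>
        {\<lambda>n. if n \<le> M then Some (y n) else None | y.
           (\<forall>n\<le>M. y n \<in> iterate_domain S n) \<and> y M \<notin> f ` D \<and>
           (\<forall>n\<in>{1..M}. f (y n) = y (n - 1))})"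

definition infinite_part :: "'a pds \<Rightarrow> (nat \<Rightarrow> 'a option) set" where
  "infinite_part S =
     (case S of (X, D, f) \<Rightarrow>
        {\<lambda>n. Some (y n) | y.
           (\<forall>n. y n \<in> iterate_domain S n) \<and> (\<forall>n\<ge>1. f (y n) = y (n - 1))})"

definition extension_space :: "'a pds \<Rightarrow> (nat \<Rightarrow> 'a option) topology" where
  "extension_space S =
     (case S of (X, D, f) \<Rightarrow>
        subtopology (product_topology (\<lambda>n. adjoin_isolated X) UNIV)
          ((\<Union>M. finite_part S M) \<union> infinite_part S))"

definition reversible_extension :: "'a pds \<Rightarrow> (nat \<Rightarrow> 'a option) pds" where
  "reversible_extension S =
     (case S of (X, D, f) \<Rightarrow>
        (extension_space S,
         {x \<in> topspace (extension_space S). x 0 \<in> Some ` D},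
         \<lambda>x. case_nat (map_option f (x 0)) x))"

end

(* Every column of A has a nonzero entry, so the one-sided shift is surjective: the finite parts of
   its reversible extension are empty, and a point of the extension is a sequence (y_0, y_1, ...)
   with y_{n+1} a preimage of y_n.  Such a sequence amounts to a two-sided sequence w, where
   y_n k = w (k - n); both directions are coordinatewise continuous. *)
theory Submission imports Defs begin

lemma continuous_map_Some: "continuous_map X (adjoin_isolated X) Some"
  unfolding continuous_map
proof (intro conjI allI impI)
  show "Some ` topspace X \<subseteq> topspace (adjoin_isolated X)"
    by (auto simp: topspace_adjoin_isolated)
  fix U assume "openin (adjoin_isolated X) U"
  then have "openin X (topspace X \<inter> {x. Some x \<in> U})"
    by (auto simp: openin_adjoin_isolated)
  then show "openin X {x \<in> topspace X. Some x \<in> U}"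
    by (simp add: Collect_conj_eq)
qed

lemma continuous_map_the:
  "continuous_map (subtopology (adjoin_isolated X) (range Some)) X the"
  unfolding continuous_map
proof (intro conjI allI impI)
  show "the ` topspace (subtopology (adjoin_isolated X) (range Some)) \<subseteq> topspace X"
    by (auto simp: topspace_adjoin_isolated)
  fix U assume U: "openin X U"
  then have "{x. Some x \<in> Some ` U} = U" "U \<subseteq> topspace X"
    by (auto simp: openin_subset)
  then have "openin (adjoin_isolated X) (Some ` U)"
    using U by (simp only: openin_adjoin_isolated)
  moreover have "{x \<in> topspace (subtopology (adjoin_isolated X) (range Some)). the x \<in> U}
      = Some ` U \<inter> range Some"
    using \<open>U \<subseteq> topspace X\<close> by (auto simp: topspace_adjoin_isolated)
  ultimately show "openin (subtopology (adjoin_isolated X) (range Some))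
      {x \<in> topspace (subtopology (adjoin_isolated X) (range Some)). the x \<in> U}"
    unfolding openin_subtopology by blast
qed

lemma iterate_domain_total:
  assumes "f ` topspace X \<subseteq> topspace X"
  shows "iterate_domain (X, topspace X, f) n = topspace X"
  by (induction n) (use assms in auto)

text \<open>The last proper coordinate of such a point would lie in \<open>X\<close> but outside the
  image of \<open>f\<close>.\<close>

lemma finite_part_surj:
  assumes "f ` topspace X = topspace X"
  shows "finite_part (X, topspace X, f) M = {}"
  using assms by (auto simp: finite_part_def iterate_domain_total)

lemma infinite_part_surj:
  assumes "f ` topspace X = topspace X"
  shows "infinite_part (X, topspace X, f) =
    {\<lambda>n. Some (y n) | y. (\<forall>n. y n \<in> topspace X) \<and> (\<forall>n. f (y (Suc n)) = y n)}"
proof -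
  have "(\<forall>n\<ge>1. f (y n) = y (n - 1)) \<longleftrightarrow> (\<forall>n. f (y (Suc n)) = y n)" for y
    by (metis Suc_le_D One_nat_def diff_Suc_1 le_add1 plus_1_eq_Suc)
  then show ?thesis
    using assms by (simp add: infinite_part_def iterate_domain_total)
qed

lemma topspace_extension_space_surj:
  assumes "f ` topspace X = topspace X"
  shows "topspace (extension_space (X, topspace X, f)) =
    {\<lambda>n. Some (y n) | y. (\<forall>n. y n \<in> topspace X) \<and> (\<forall>n. f (y (Suc n)) = y n)}"
  unfolding extension_space_def
  by (auto simp: finite_part_surj[OF assms] infinite_part_surj[OF assms]
      topspace_adjoin_isolated)

text \<open>No point of the extension has a coordinate \<open>None\<close>, so each projection lands
  in \<open>range Some\<close>, where \<open>the\<close> is continuous.\<close>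

lemma continuous_map_extension_space_coordinate:
  assumes "f ` topspace X = topspace X"
  shows "continuous_map (extension_space (X, topspace X, f)) X (\<lambda>z. the (z n))"
proof -
  let ?E = "extension_space (X, topspace X, f)"
  have "continuous_map ?E (adjoin_isolated X) (\<lambda>z. z n)"
    unfolding extension_space_def prod.case
    by (intro continuous_map_from_subtopology continuous_map_product_projection) simp
  moreover have "(\<lambda>z. z n) ` topspace ?E \<subseteq> range Some"
    unfolding topspace_extension_space_surj[OF assms] by auto
  ultimately have "continuous_map ?E (subtopology (adjoin_isolated X) (range Some)) (\<lambda>z. z n)"
    by (auto simp: continuous_map_in_subtopology)
  from continuous_map_compose[OF this continuous_map_the] show ?thesis
    by (simp add: o_def)
qed

lemma topspace_one_sided_space:
  "topspace (one_sided_space N A) = {x. \<forall>k. x k \<in> {1..N} \<and> A (x k) (x (k + 1)) = 1}"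
  by (auto simp: one_sided_space_def)

lemma topspace_two_sided_space:
  "topspace (two_sided_space N A) = {x. \<forall>k. x k \<in> {1..N} \<and> A (x k) (x (k + 1)) = 1}"
  by (auto simp: two_sided_space_def)

lemma continuous_map_one_sided_space_coordinate:
  "continuous_map (one_sided_space N A) (discrete_topology {1..N}) (\<lambda>x. x k)"
  unfolding one_sided_space_def
  by (intro continuous_map_from_subtopology continuous_map_product_projection) simp

lemma continuous_map_two_sided_space_coordinate:
  "continuous_map (two_sided_space N A) (discrete_topology {1..N}) (\<lambda>x. x k)"
  unfolding two_sided_space_def
  by (intro continuous_map_from_subtopology continuous_map_product_projection) simp

lemma one_sided_shift_surj:
  assumes entries: "\<forall>i\<in>{1..N}. \<forall>j\<in>{1..N}. A i j \<in> {0, 1}"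
    and cols: "\<forall>j\<in>{1..N}. \<exists>i\<in>{1..N}. A i j \<noteq> 0"
  shows "(\<lambda>x k. x (k + 1)) ` topspace (one_sided_space N A) = topspace (one_sided_space N A)"
proof (intro equalityI subsetI)
  fix x assume x: "x \<in> topspace (one_sided_space N A)"
  then have "x 0 \<in> {1..N}"
    by (auto simp: topspace_one_sided_space)
  \<comment> \<open>Column \<open>x 0\<close> has a nonzero entry, necessarily 1; prepending its row
    index \<open>i\<close> to \<open>x\<close> gives a preimage.\<close>
  then obtain i where i: "i \<in> {1..N}" "A i (x 0) = 1"
    using entries cols by (metis insertE singletonD)
  have "case_nat i x \<in> topspace (one_sided_space N A)"
    using x i unfolding topspace_one_sided_space by (auto split: nat.split)
  moreover have "x = (\<lambda>k. case_nat i x (k + 1))"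
    by simp
  ultimately show "x \<in> (\<lambda>x k. x (k + 1)) ` topspace (one_sided_space N A)"
    by blast
qed (auto simp: topspace_one_sided_space)

text \<open>Coordinate \<open>n\<close> is the right half of \<open>w\<close> cut at position
  \<open>-n\<close>, so each further coordinate reveals one more symbol of the past.\<close>

definition histories :: "(int \<Rightarrow> nat) \<Rightarrow> nat \<Rightarrow> (nat \<Rightarrow> nat) option" where
  "histories w = (\<lambda>n. Some (\<lambda>k. w (int k - int n)))"

(* One of nat m and nat (- m) is always 0: the entry at m \<ge> 0 is read off y_0, and the entry at
   m < 0 is the first entry of y_{-m}. *)
definition glue :: "(nat \<Rightarrow> (nat \<Rightarrow> nat) option) \<Rightarrow> int \<Rightarrow> nat" where
  "glue z = (\<lambda>m. the (z (nat (- m))) (nat m))"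

text \<open>\<open>glue\<close> looks up \<open>w\<close> at position
  \<open>int (nat m) - int (nat (- m))\<close>, which is \<open>m\<close>.\<close>

lemma glue_histories: "glue (histories w) = w"
  by (auto simp: glue_def histories_def fun_eq_iff intro!: arg_cong[where f = w])

text \<open>By compatibility \<open>y n k\<close> depends only on \<open>k - n\<close>, while
  \<open>glue\<close> reads it where \<open>k\<close> or \<open>n\<close> is 0. The induction moves
  down the diagonal to such a pair.\<close>

lemma glue_shift_coordinate:
  assumes "\<And>n. (\<lambda>k. y (Suc n) (k + 1)) = y n"
  shows "glue (\<lambda>n. Some (y n)) (int k - int n) = y n k"
proof (induction n arbitrary: k)
  case (Suc n)
  show ?case
  proof (cases k)
    case 0
    then show ?thesis
      by (simp add: glue_def nat_add_distrib)
  next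
    case (Suc j)
    then show ?thesis
      using Suc.IH[of j] fun_cong[OF assms[of n], of j] by simp
  qed
qed (simp add: glue_def)

lemma histories_glue:
  assumes "\<And>n. (\<lambda>k. y (Suc n) (k + 1)) = y n"
  shows "histories (glue (\<lambda>n. Some (y n))) = (\<lambda>n. Some (y n))"
  unfolding histories_def using glue_shift_coordinate[of y, OF assms] by presburger

text \<open>At \<open>m \<ge> 0\<close> both sides read \<open>x\<close> at
  \<open>nat m + 1\<close>. At \<open>m < 0\<close> the coordinate prepended by
  \<open>case_nat\<close> compensates for the shift of \<open>m\<close> by one.\<close>

lemma glue_extension_map:
  assumes "z 0 = Some x"
  shows "glue (case_nat (map_option (\<lambda>x k. x (k + 1)) (z 0)) z) = (\<lambda>m. glue z (m + 1))"
proof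
  fix m :: int
  show "glue (case_nat (map_option (\<lambda>x k. x (k + 1)) (z 0)) z) m = glue z (m + 1)"
  proof (cases "m \<ge> 0")
    case True
    then show ?thesis
      using assms by (simp add: glue_def nat_add_distrib)
  next
    case False
    \<comment> \<open>Here \<open>nat (- m)\<close> is \<open>Suc j\<close>, so
      \<open>case_nat\<close> returns \<open>z j\<close>, the coordinate that \<open>glue z\<close>
      reads at \<open>m + 1 = - int j\<close>.\<close>
    define j where "j = nat (- (m + 1))"
    from False have "m = - int j - 1"
      by (simp add: j_def)
    then show ?thesis
      by (simp add: glue_def nat_add_distrib)
  qed
qed

text \<open>The inverse laws are \<open>glue_histories\<close> and \<open>histories_glue\<close>. It
  remains to see that each map lands in the other space and is continuous, which is checked entry by
  entry because the topologies come from products.\<close>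

lemma homeomorphic_maps_glue_histories:
  fixes N :: nat and A :: "nat \<Rightarrow> nat \<Rightarrow> nat"
  assumes entries: "\<forall>i\<in>{1..N}. \<forall>j\<in>{1..N}. A i j \<in> {0, 1}"
    and cols: "\<forall>j\<in>{1..N}. \<exists>i\<in>{1..N}. A i j \<noteq> 0"
  shows "homeomorphic_maps (extension_space (one_sided_subshift N A)) (two_sided_space N A)
    glue histories"
proof -
  define X where "X = one_sided_space N A"
  define f :: "(nat \<Rightarrow> nat) \<Rightarrow> nat \<Rightarrow> nat" where "f = (\<lambda>x k. x (k + 1))"
  let ?E = "extension_space (X, topspace X, f)" and ?Y = "two_sided_space N A"
  have surj: "f ` topspace X = topspace X"
    unfolding X_def f_def using one_sided_shift_surj[OF assms] .
  note E = topspace_extension_space_surj[OF surj]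
  have ext_cases: "\<exists>y. z = (\<lambda>n. Some (y n)) \<and> (\<forall>n. y n \<in> topspace X) \<and>
      (\<forall>n. (\<lambda>k. y (Suc n) (k + 1)) = y n)" if "z \<in> topspace ?E" for z
    using that unfolding E unfolding f_def by (rule CollectD)
  have glue_in: "glue z \<in> topspace ?Y" if z_in: "z \<in> topspace ?E" for z
  proof -
    obtain y where z: "z = (\<lambda>n. Some (y n))" and y: "\<forall>n. y n \<in> topspace X"
      and step: "\<forall>n. (\<lambda>k. y (Suc n) (k + 1)) = y n"
      using ext_cases[OF z_in] by blast
    \<comment> \<open>Two neighbouring entries are found side by side in one coordinate of
      \<open>z\<close>, so the transition between them is allowed because that coordinate lies in
      \<open>X\<close>.\<close>
    have "glue z m = y (nat (- m)) (nat m)"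
      "glue z (m + 1) = y (nat (- m)) (nat m + 1)" for m
    proof -
      have "int (nat m) - int (nat (- m)) = m"
        "int (nat m + 1) - int (nat (- m)) = m + 1"
        by auto
      then show "glue z m = y (nat (- m)) (nat m)"
        "glue z (m + 1) = y (nat (- m)) (nat m + 1)"
        unfolding z using glue_shift_coordinate[of y, OF step[rule_format]] by metis+
    qed
    then show ?thesis
      using y unfolding topspace_two_sided_space X_def topspace_one_sided_space by auto
  qed
  have hist_in: "histories w \<in> topspace ?E" if "w \<in> topspace ?Y" for w
    unfolding E mem_Collect_eq
  proof (intro exI conjI allI)
    show "histories w = (\<lambda>n. Some (\<lambda>k. w (int k - int n)))"
      by (simp add: histories_def)
    fix n
    show "f (\<lambda>k. w (int k - int (Suc n))) = (\<lambda>k. w (int k - int n))"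
      by (simp add: f_def)
    have "int (k + 1) - int n = (int k - int n) + 1" for k
      by simp
    then show "(\<lambda>k. w (int k - int n)) \<in> topspace X"
      using that unfolding X_def topspace_one_sided_space topspace_two_sided_space mem_Collect_eq
      by presburger
  qed
  have "continuous_map ?E (product_topology (\<lambda>_. discrete_topology {1..N}) UNIV) glue"
    unfolding continuous_map_componentwise_UNIV
  proof
    fix m
    \<comment> \<open>For fixed \<open>m\<close> the indices \<open>nat (- m)\<close> and
      \<open>nat m\<close> are constants, so the map is a composite of two coordinate maps.\<close>
    show "continuous_map ?E (discrete_topology {1..N}) (\<lambda>z. glue z m)"
      using continuous_map_compose[OF continuous_map_extension_space_coordinate[OF surj]
          continuous_map_one_sided_space_coordinate[of N A, folded X_def]]
      by (simp add: glue_def o_def)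
  qed
  then have cont_glue: "continuous_map ?E ?Y glue"
    using glue_in unfolding two_sided_space_def
    by (auto simp: continuous_map_in_subtopology)
  have "continuous_map ?Y (product_topology (\<lambda>_. adjoin_isolated X) UNIV) histories"
    unfolding continuous_map_componentwise_UNIV
  proof
    fix n
    \<comment> \<open>Each coordinate of \<open>histories\<close> is itself a sequence: continuity
      is shown first into the full product, then into \<open>X\<close>, and finally through
      \<open>Some\<close>.\<close>
    have "continuous_map ?Y (product_topology (\<lambda>_. discrete_topology {1..N}) UNIV)
        (\<lambda>w k. w (int k - int n))"
      unfolding continuous_map_componentwise_UNIV
      by (intro allI continuous_map_two_sided_space_coordinate)
    moreover have "(\<lambda>k. w (int k - int n)) \<in> topspace X" if "w \<in> topspace ?Y" for w
      using hist_in[OF that] unfolding E histories_def by (auto simp: fun_eq_iff)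
    ultimately have "continuous_map ?Y X (\<lambda>w k. w (int k - int n))"
      unfolding X_def one_sided_space_def by (auto simp: continuous_map_in_subtopology)
    from continuous_map_compose[OF this continuous_map_Some]
    show "continuous_map ?Y (adjoin_isolated X) (\<lambda>w. histories w n)"
      by (simp add: histories_def o_def)
  qed
  then have cont_hist: "continuous_map ?Y ?E histories"
    using hist_in unfolding extension_space_def
    by (auto simp: continuous_map_in_subtopology)
  have "histories (glue z) = z" if "z \<in> topspace ?E" for z
    using ext_cases[OF that] by (elim exE conjE) (simp only: histories_glue)
  then have "homeomorphic_maps ?E ?Y glue histories"
    using cont_glue cont_hist glue_histories by (simp add: homeomorphic_maps_def)
  then show ?thesis
    by (simp add: one_sided_subshift_def X_def f_def)
qed

theorem proposition2p8:
  fixes N :: nat and A :: "nat \<Rightarrow> nat \<Rightarrow> nat"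
  assumes entries: "\<forall>i\<in>{1..N}. \<forall>j\<in>{1..N}. A i j \<in> {0, 1}"
    and rows: "\<forall>i\<in>{1..N}. \<exists>j\<in>{1..N}. A i j \<noteq> 0"
    and cols: "\<forall>j\<in>{1..N}. \<exists>i\<in>{1..N}. A i j \<noteq> 0"
  shows "topologically_conjugate
           (reversible_extension (one_sided_subshift N A)) (two_sided_subshift N A)"
proof -
  let ?X = "one_sided_space N A"
  let ?E = "extension_space (one_sided_subshift N A)"
  have hom: "homeomorphic_map ?E (two_sided_space N A) glue"
    using homeomorphic_maps_glue_histories[OF entries cols] homeomorphic_map_maps by blast
  \<comment> \<open>Every coordinate is \<open>Some\<close> of a point of \<open>X\<close>, on all
    of which the shift is defined; hence the extended map is defined everywhere, as the two-sided
    shift is.\<close>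
  have dom: "{z \<in> topspace ?E. z 0 \<in> Some ` topspace ?X} = topspace ?E"
    unfolding one_sided_subshift_def
      topspace_extension_space_surj[OF one_sided_shift_surj[OF entries cols]]
    by auto
  have img: "glue ` topspace ?E = topspace (two_sided_space N A)"
    using hom by (simp add: homeomorphic_imp_surjective_map)
  have "glue (case_nat (map_option (\<lambda>x k. x (k + 1)) (z 0)) z) = (\<lambda>m. glue z (m + 1))"
    if "z \<in> topspace ?E" for z
    using that dom glue_extension_map by blast
  then have "topologically_conjugate
      (?E, {z \<in> topspace ?E. z 0 \<in> Some ` topspace ?X},
        \<lambda>z. case_nat (map_option (\<lambda>x k. x (k + 1)) (z 0)) z)
      (two_sided_subshift N A)"
    unfolding topologically_conjugate_def two_sided_subshift_def dom prod.case
    using hom img by blast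
  then show ?thesis
    by (simp only: reversible_extension_def one_sided_subshift_def prod.case)
qed

end
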